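(* The restriction of $g_2$ to $\mathcal F_\pm$ equals $dR^2+R^2\widehat g_2$, where $$\widehat g_2=\begin{cases}\tfrac12|d\boldsymbol\sigma|^2+\tfrac14d\phi^2&\text{on }\mathcal F_+,\\[4pt]\tfrac18(3+\cos2\phi)|d\boldsymbol\sigma|^2+\tfrac12d\phi^2&\text{on }\mathcal F_-.\end{cases}$$
   Context: Let $x_0,\dots,x_7$ be the standard coordinates on $\mathbb R^8$, with partial derivatives $\partial_i$, and let $e=\sum_i dx_i\otimes dx_i$ and $R=\sum_i x_i^2$. Put $X=-x_1\partial_0+x_0\partial_1-x_3\partial_2+x_2\partial_3-x_5\partial_4+x_4\partial_5-x_7\partial_6+x_6\partial_7$, $Y_1=-x_1\partial_0+x_0\partial_1+x_3\partial_2-x_2\partial_3-x_5\partial_4+x_4\partial_5+x_7\partial_6-x_6\partial_7$, $Y_2=-x_2\partial_0+x_0\partial_2+x_1\partial_3-x_3\partial_1-x_6\partial_4+x_4\partial_6+x_5\partial_7-x_7\partial_5$, $Y_3=-x_3\partial_0+x_0\partial_3+x_2\partial_1-x_1\partial_2-x_7\partial_4+x_4\partial_7+x_6\partial_5-x_5\partial_6$, and $\alpha_i=e(Y_i,\cdot)$. The flow of $Y_1$ is a free circle action on $\mathbb R^8\setminus0$ with quotient $\mathcal C=\mathbb R^+\times\mathbb{CP}^3$; tensors on $\mathcal C$ are identified with their pullbacks to $\mathbb R^8\setminus 0$. The conical metric with holonomy $G_2$ on $\mathcal C$ is $h_2=\tfrac12dR^2+2R\,e-2\alpha_1^2-\alpha_2^2-\alpha_3^2$.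 The vector field $X$ generates a circle action on $\mathcal C$; its quotient is $Q:\mathcal C\to\mathcal M\cong\mathbb R^6\setminus0$, with coordinates $(\mathbf u,\mathbf v)=(u_1,u_2,u_3;v_1,v_2,v_3)$ given by $u_1=x_0^2+x_1^2-x_4^2-x_5^2$, $u_2=2(x_0x_4+x_1x_5)$, $u_3=2(x_0x_5-x_1x_4)$, $v_1=x_2^2+x_3^2-x_6^2-x_7^2$, $v_2=2(x_2x_6+x_3x_7)$, $v_3=2(x_2x_7-x_3x_6)$. Also $u=|\mathbf u|$, $v=|\mathbf v|$, $R=u+v$. With $N=h_2(X,X)$ and $\Theta_2=\frac2Nh_2(X,\cdot)$, the metric $g_2$ on $\mathcal M$ (where $uv\ne0$) is determined by $h_2=Q^*g_2+\tfrac14N\,\Theta_2\otimes\Theta_2$. Let $\mathcal F_\pm=\{(\mathbf u,\mathbf v)\in\mathcal M: v\mathbf u\mp u\mathbf v=\mathbf 0\}$; where $uv\neq0$, $\mathcal F_+$ (resp. $\mathcal F_-$) consists of pairs of parallel vectors pointing in the same (resp. opposite) direction. Coordinates $(R,\phi,\boldsymbol\sigma)\in\mathbb R^+\times[0,\pi]\times S^2$ on $\mathcal F_\pm$ are defined by $u=R\cos^2(\phi/2)$, $v=R\sin^2(\phi/2)$, $\mathbf u=u\boldsymbol\sigma$, $\mathbf v=\pm v\boldsymbol\sigma$; here $|d\boldsymbol\sigma|^2=d\boldsymbol\sigma\cdot d\boldsymbol\sigma$ is the round metric on the unit sphere $S^2$. *)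

theory Defs
  imports "HOL-Analysis.Analysis"
begin

section \<open>The cone \<open>\<real>\<^sup>+ \<times> CP\<^sup>3\<close>, via \<open>\<real>\<^sup>8\<close>\<close>

text \<open>
  The coordinates \<open>x\<^sub>0, \<dots>, x\<^sub>7\<close> are the components \<open>x $ 0, \<dots>, x $ 7\<close> for the index type \<open>8\<close> of
  integers modulo 8.  A vector field is a function of the base point, and a
  covariant 2-tensor is a function of the base point and two tangent vectors.  Tensors on the cone
  are represented by their pullbacks to \<open>\<real>\<^sup>8\<close> minus the origin.
\<close>

abbreviation dd :: "8 \<Rightarrow> real^8" where
  "dd i \<equiv> axis i 1"

definition Rsq :: "real^8 \<Rightarrow> real" where
  "Rsq x = (\<Sum>i\<in>UNIV. (x $ i)\<^sup>2)"

definition X :: "real^8 \<Rightarrow> real^8" where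
  "X x = - (x$1) *\<^sub>R dd 0 + x$0 *\<^sub>R dd 1 - x$3 *\<^sub>R dd 2 + x$2 *\<^sub>R dd 3
         - x$5 *\<^sub>R dd 4 + x$4 *\<^sub>R dd 5 - x$7 *\<^sub>R dd 6 + x$6 *\<^sub>R dd 7"

definition Y1 :: "real^8 \<Rightarrow> real^8" where
  "Y1 x = - (x$1) *\<^sub>R dd 0 + x$0 *\<^sub>R dd 1 + x$3 *\<^sub>R dd 2 - x$2 *\<^sub>R dd 3
          - x$5 *\<^sub>R dd 4 + x$4 *\<^sub>R dd 5 + x$7 *\<^sub>R dd 6 - x$6 *\<^sub>R dd 7"

definition Y2 :: "real^8 \<Rightarrow> real^8" where
  "Y2 x = - (x$2) *\<^sub>R dd 0 + x$0 *\<^sub>R dd 2 + x$1 *\<^sub>R dd 3 - x$3 *\<^sub>R dd 1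
          - x$6 *\<^sub>R dd 4 + x$4 *\<^sub>R dd 6 + x$5 *\<^sub>R dd 7 - x$7 *\<^sub>R dd 5"

definition Y3 :: "real^8 \<Rightarrow> real^8" where
  "Y3 x = - (x$3) *\<^sub>R dd 0 + x$0 *\<^sub>R dd 3 + x$2 *\<^sub>R dd 1 - x$1 *\<^sub>R dd 2
          - x$7 *\<^sub>R dd 4 + x$4 *\<^sub>R dd 7 + x$6 *\<^sub>R dd 5 - x$5 *\<^sub>R dd 6"

definition h2 :: "real^8 \<Rightarrow> real^8 \<Rightarrow> real^8 \<Rightarrow> real" where
  "h2 x V W =
     1/2 * frechet_derivative Rsq (at x) V * frechet_derivative Rsq (at x) W
     + 2 * Rsq x * (V \<bullet> W)
     - 2 * (Y1 x \<bullet> V) * (Y1 x \<bullet> W) - (Y2 x \<bullet> V) * (Y2 x \<bullet> W) - (Y3 x \<bullet> V) * (Y3 x \<bullet> W)"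

definition N :: "real^8 \<Rightarrow> real" where
  "N x = h2 x (X x) (X x)"

definition Theta2 :: "real^8 \<Rightarrow> real^8 \<Rightarrow> real" where
  "Theta2 x V = 2 / N x * h2 x (X x) V"


section \<open>The circle quotient and its metric\<close>

text \<open>
  The composite of \<open>\<real>\<^sup>8\<close> minus the origin \<open>\<rightarrow>\<close> cone with the quotient map from the cone to
  \<open>\<real>\<^sup>6\<close> minus the origin.
\<close>

definition Q :: "real^8 \<Rightarrow> (real^3) \<times> (real^3)" where
  "Q x =
    (vector [(x$0)\<^sup>2 + (x$1)\<^sup>2 - (x$4)\<^sup>2 - (x$5)\<^sup>2, 2 * (x$0 * x$4 + x$1 * x$5), 2 * (x$0 * x$5 - x$1 * x$4)],
     vector [(x$2)\<^sup>2 + (x$3)\<^sup>2 - (x$6)\<^sup>2 - (x$7)\<^sup>2, 2 * (x$2 * x$6 + x$3 * x$7), 2 * (x$2 * x$7 - x$3 * x$6)])"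

definition regular :: "((real^3) \<times> (real^3)) set" where
  "regular = {(U, V). norm U * norm V \<noteq> 0}"

text \<open>
  The bilinear form on the tangent space at \<open>q\<close> determined by
  \<open>h\<^sub>2 = Q\<^sup>* g\<^sub>2 + (1/4) N \<Theta>\<^sub>2 \<otimes> \<Theta>\<^sub>2\<close> at every point over \<open>q\<close>.  It is only meaningful for \<open>q\<close> in
  \<open>regular\<close>, where \<open>Q\<close> is a submersion onto a neighbourhood of \<open>q\<close>; symmetry then follows from that of \<open>h\<^sub>2\<close>.
\<close>

definition g2 :: "(real^3) \<times> (real^3) \<Rightarrow> (real^3) \<times> (real^3) \<Rightarrow> (real^3) \<times> (real^3) \<Rightarrow> real" where
  "g2 q = (THE g. bilinear g \<and>
     (\<forall>x V W. Q x = q \<longrightarrow>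
        h2 x V W = g (frechet_derivative Q (at x) V) (frechet_derivative Q (at x) W)
                   + 1/4 * N x * (Theta2 x V * Theta2 x W)))"


section \<open>The submanifolds \<open>\<F>\<^sub>\<plusminus>\<close> and their coordinates\<close>

text \<open>The sign is a real parameter \<open>\<epsilon>\<close>, equal to \<open>1\<close> or \<open>- 1\<close>.\<close>

definition F :: "real \<Rightarrow> ((real^3) \<times> (real^3)) set" where
  "F \<epsilon> = {(U, V). (U, V) \<noteq> 0 \<and> norm V *\<^sub>R U - \<epsilon> *\<^sub>R (norm U *\<^sub>R V) = 0}"

text \<open>
  The point with coordinates \<open>(R, \<phi>, \<sigma>)\<close>.  The formula is defined for all \<open>\<sigma>\<close> in the ambient
  space, and its derivative is only to be applied to vectors tangent to the sphere.
\<close>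

definition param :: "real \<Rightarrow> real \<times> real \<times> (real^3) \<Rightarrow> (real^3) \<times> (real^3)" where
  "param \<epsilon> = (\<lambda>(R, \<phi>, \<sigma>). ((R * (cos (\<phi>/2))\<^sup>2) *\<^sub>R \<sigma>, \<epsilon> *\<^sub>R ((R * (sin (\<phi>/2))\<^sup>2) *\<^sub>R \<sigma>)))"

text \<open>The restriction of \<open>g\<^sub>2\<close> to \<open>\<F>\<^sub>\<plusminus>\<close>, written in these coordinates.\<close>

definition g2_on_F ::
    "real \<Rightarrow> real \<times> real \<times> (real^3) \<Rightarrow> real \<times> real \<times> (real^3) \<Rightarrow> real \<times> real \<times> (real^3) \<Rightarrow> real" where
  "g2_on_F \<epsilon> p a b =
     g2 (param \<epsilon> p) (frechet_derivative (param \<epsilon>) (at p) a) (frechet_derivative (param \<epsilon>) (at p) b)"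

lemma bij_betw_param:
  assumes "\<epsilon> \<in> {1, -1}"
  shows "bij_betw (param \<epsilon>) {(R, \<phi>, \<sigma>). R > 0 \<and> 0 < \<phi> \<and> \<phi> < pi \<and> norm \<sigma> = 1} (F \<epsilon> \<inter> regular)"
    (is "bij_betw _ ?D _")
proof -
  have e: "\<epsilon> * \<epsilon> = 1" "\<bar>\<epsilon>\<bar> = 1" using assms by auto
  have cs: "cos (\<phi>/2) > 0" "sin (\<phi>/2) > 0" if "0 < \<phi>" "\<phi> < pi" for \<phi> :: real
    using that by (auto intro!: cos_gt_zero_pi sin_gt_zero)
  have nrm: "norm (fst (param \<epsilon> (R, \<phi>, \<sigma>))) = R * (cos (\<phi>/2))\<^sup>2"
            "norm (snd (param \<epsilon> (R, \<phi>, \<sigma>))) = R * (sin (\<phi>/2))\<^sup>2"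
    if "R > 0" "norm \<sigma> = 1" for R \<phi> and \<sigma> :: "real^3"
    using that e by (auto simp: param_def abs_mult)
  have "inj_on (param \<epsilon>) ?D"
  proof (rule inj_onI)
    fix p p'
    assume "p \<in> ?D" "p' \<in> ?D" and eq': "param \<epsilon> p = param \<epsilon> p'"
    then obtain R \<phi> \<sigma> R' \<phi>' \<sigma>' where p: "p = (R, \<phi>, \<sigma>)" "p' = (R', \<phi>', \<sigma>')"
      and *: "0 < R" "0 < \<phi>" "\<phi> < pi" "norm \<sigma> = 1" "0 < R'" "0 < \<phi>'" "\<phi>' < pi" "norm \<sigma>' = 1"
      by auto
    have eq: "param \<epsilon> (R, \<phi>, \<sigma>) = param \<epsilon> (R', \<phi>', \<sigma>')" using eq' p by simp
    have c: "R * (cos (\<phi>/2))\<^sup>2 = R' * (cos (\<phi>'/2))\<^sup>2" and s: "R * (sin (\<phi>/2))\<^sup>2 = R' * (sin (\<phi>'/2))\<^sup>2"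
      using nrm[of R \<sigma> \<phi>] nrm[of R' \<sigma>' \<phi>'] * eq by auto
    have "R * ((cos (\<phi>/2))\<^sup>2 + (sin (\<phi>/2))\<^sup>2) = R' * ((cos (\<phi>'/2))\<^sup>2 + (sin (\<phi>'/2))\<^sup>2)"
      using c s by (simp only: distrib_left)
    hence R: "R = R'" by simp
    hence "(cos (\<phi>/2))\<^sup>2 = (cos (\<phi>'/2))\<^sup>2" using c * by simp
    hence "cos (\<phi>/2) = cos (\<phi>'/2)" using cs[of \<phi>] cs[of \<phi>'] * by (simp add: power2_eq_iff)
    hence "\<phi>/2 = \<phi>'/2" using cos_inj_pi[of "\<phi>/2" "\<phi>'/2"] * by auto
    hence \<phi>: "\<phi> = \<phi>'" by simp
    have "(R * (cos (\<phi>/2))\<^sup>2) *\<^sub>R \<sigma> = (R * (cos (\<phi>/2))\<^sup>2) *\<^sub>R \<sigma>'"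
      using eq R \<phi> by (simp add: param_def)
    hence "\<sigma> = \<sigma>'" using * cs[of \<phi>] by simp
    with R \<phi> show "p = p'" using p by simp
  qed
  moreover have "param \<epsilon> ` ?D \<subseteq> F \<epsilon> \<inter> regular"
  proof (rule image_subsetI)
    fix p assume "p \<in> ?D"
    then obtain R \<phi> \<sigma> where p: "p = (R, \<phi>, \<sigma>)"
      and *: "0 < R" "0 < \<phi>" "\<phi> < pi" "norm \<sigma> = 1"
      by auto
    obtain a b where ab: "param \<epsilon> (R, \<phi>, \<sigma>) = (a, b)" by force
    have n: "norm a = R * (cos (\<phi>/2))\<^sup>2" "norm b = R * (sin (\<phi>/2))\<^sup>2"
      using nrm[of R \<sigma> \<phi>] * ab by auto
    have pos: "norm a > 0" "norm b > 0" using n * cs[of \<phi>] by auto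
    have "norm b *\<^sub>R a - \<epsilon> *\<^sub>R (norm a *\<^sub>R b) = 0"
      using ab e unfolding n by (auto simp: param_def mult_ac)
    with pos show "param \<epsilon> p \<in> F \<epsilon> \<inter> regular"
      by (auto simp: p ab F_def regular_def zero_prod_def)
  qed
  moreover have "F \<epsilon> \<inter> regular \<subseteq> param \<epsilon> ` ?D"
  proof (rule subsetI)
    fix q assume "q \<in> F \<epsilon> \<inter> regular"
    then obtain a b where ab: "q = (a, b)" and F: "(a, b) \<in> F \<epsilon>" and reg: "(a, b) \<in> regular"
      by (cases q) auto
    define R where "R = norm a + norm b"
    define \<phi> where "\<phi> = 2 * arccos (sqrt (norm a / R))"
    define \<sigma> where "\<sigma> = (1 / norm a) *\<^sub>R a"
    have pos: "norm a > 0" "norm b > 0" "R > 0" using reg by (auto simp: regular_def R_def add_pos_pos)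
    have q: "0 < norm a / R" "norm a / R < 1" using pos by (auto simp: R_def)
    hence sq: "0 < sqrt (norm a / R)" "sqrt (norm a / R) < 1" by auto
    have c: "cos (\<phi>/2) = sqrt (norm a / R)" 
    proof -
      have "\<phi>/2 = arccos (sqrt (norm a / R))" by (simp add: \<phi>_def)
      moreover have "-1 \<le> sqrt (norm a / R)" "sqrt (norm a / R) \<le> 1" using sq by linarith+
      ultimately show ?thesis by (simp only: cos_arccos)
    qed
    hence c2: "R * (cos (\<phi>/2))\<^sup>2 = norm a" using q pos by simp
    have s2: "R * (sin (\<phi>/2))\<^sup>2 = norm b"
      using c2 by (simp add: sin_squared_eq right_diff_distrib R_def)
    have "arccos (sqrt (norm a / R)) < pi / 2"
      using arccos_less_arccos[of 0 "sqrt (norm a / R)"] sq by (simp only: arccos_0)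
    moreover have "0 < arccos (sqrt (norm a / R))"
      using arccos_less_arccos[of "sqrt (norm a / R)" 1] sq by (simp only: arccos_1)
    ultimately have \<phi>: "0 < \<phi>" "\<phi> < pi" unfolding \<phi>_def by linarith+
    have "norm \<sigma> = 1" using pos by (simp add: \<sigma>_def)
    moreover have "norm a *\<^sub>R \<sigma> = a" using pos by (simp add: \<sigma>_def)
    moreover have "\<epsilon> *\<^sub>R (norm b *\<^sub>R \<sigma>) = b"
    proof -
      have "norm b *\<^sub>R a = (\<epsilon> * norm a) *\<^sub>R b" using F by (simp add: F_def)
      hence "\<epsilon> *\<^sub>R (norm b *\<^sub>R \<sigma>) = (\<epsilon> * (1 / norm a)) *\<^sub>R ((\<epsilon> * norm a) *\<^sub>R b)"
        by (metis \<sigma>_def scaleR_left_commute scaleR_scaleR)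
      thus ?thesis using pos e by (simp add: mult_ac)
    qed
    ultimately have "q = param \<epsilon> (R, \<phi>, \<sigma>)" "(R, \<phi>, \<sigma>) \<in> ?D"
      using c2 s2 \<phi> pos by (simp_all add: ab param_def)
    thus "q \<in> param \<epsilon> ` ?D" by (rule image_eqI)
  qed
  ultimately show ?thesis by (auto simp: bij_betw_def)
qed

end

theory Submission
  imports Defs
begin

text \<open>
  Write \<open>z = (x\<^sub>0 + i x\<^sub>1, x\<^sub>4 + i x\<^sub>5)\<close> and \<open>w = (x\<^sub>2 + i x\<^sub>3, x\<^sub>6 + i x\<^sub>7)\<close>.  Then \<open>Q\<close> is a pair of
  Hopf maps, whose fibres are tangent to \<open>X\<close> and \<open>Y\<^sub>1\<close>, and the action of \<open>\<real>\<^sup>3\<close> on \<open>\<complex>\<^sup>2\<close> by Pauli matrices,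
  applied to \<open>z\<close> and to \<open>w\<close>, supplies lifts orthogonal to the fibres.  The form
  \<open>h\<^sub>2 - h\<^sub>2(X,\<cdot>) h\<^sub>2(X,\<cdot>) / N\<close> annihilates \<open>X\<close> and \<open>Y\<^sub>1\<close>, and its value on two lifts depends on
  \<open>(\<^bold>u, \<^bold>v)\<close> only.  This gives \<open>g\<^sub>2\<close> wherever \<open>uv \<noteq> 0\<close>; for parallel \<open>\<^bold>u\<close> and \<open>\<^bold>v\<close> the term
  coming from \<open>h\<^sub>2(X,\<cdot>)\<close>, a triple product with \<open>\<^bold>v \<times> \<^bold>u\<close>, vanishes.
\<close>

section \<open>Coordinates on the two Euclidean spaces\<close>

lemma exhaust_8:
  fixes i :: 8
  shows "i = 0 \<or> i = 1 \<or> i = 2 \<or> i = 3 \<or> i = 4 \<or> i = 5 \<or> i = 6 \<or> i = 7"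
proof (induct i)
  case (of_int z)
  then have "0 \<le> z" "z < 8" by simp_all
  then have "z = 0 \<or> z = 1 \<or> z = 2 \<or> z = 3 \<or> z = 4 \<or> z = 5 \<or> z = 6 \<or> z = 7" by arith
  then show ?case by (elim disjE) simp_all
qed

lemma UNIV_8: "(UNIV :: 8 set) = {0, 1, 2, 3, 4, 5, 6, 7}"
  using exhaust_8 by blast

lemma sum_8: "(\<Sum>i\<in>UNIV. f i) = f 0 + f 1 + f 2 + f 3 + f 4 + f 5 + f 6 + f 7"
  for f :: "8 \<Rightarrow> real"
  unfolding UNIV_8 by (subst sum.insert, simp, simp)+ simp

lemma inner_8: "V \<bullet> W = V$0 * W$0 + V$1 * W$1 + V$2 * W$2 + V$3 * W$3
    + V$4 * W$4 + V$5 * W$5 + V$6 * W$6 + V$7 * W$7" for V W :: "real^8"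
  by (simp add: inner_vec_def sum_8)

lemma forall_8: "(\<forall>i. p i) \<longleftrightarrow> p 0 \<and> p 1 \<and> p 2 \<and> p 3 \<and> p 4 \<and> p 5 \<and> p 6 \<and> p 7"
  for p :: "8 \<Rightarrow> bool"
proof
  assume p: "p 0 \<and> p 1 \<and> p 2 \<and> p 3 \<and> p 4 \<and> p 5 \<and> p 6 \<and> p 7"
  show "\<forall>i. p i"
  proof
    fix i show "p i" using exhaust_8[of i] p by (elim disjE) simp_all
  qed
qed simp

lemma inner_3: "U \<bullet> V = U$1 * V$1 + U$2 * V$2 + U$3 * V$3" for U V :: "real^3"
  by (simp add: inner_vec_def sum_3)

section \<open>Vector fields, \<open>h2\<close> and the differential of \<open>Q\<close> in
  components\<close>

lemma X_nth [simp]: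
  "X x $ 0 = - x$1" "X x $ 1 = x$0" "X x $ 2 = - x$3" "X x $ 3 = x$2"
  "X x $ 4 = - x$5" "X x $ 5 = x$4" "X x $ 6 = - x$7" "X x $ 7 = x$6"
  by (simp_all add: X_def axis_def)

lemma Y1_nth [simp]:
  "Y1 x $ 0 = - x$1" "Y1 x $ 1 = x$0" "Y1 x $ 2 = x$3" "Y1 x $ 3 = - x$2"
  "Y1 x $ 4 = - x$5" "Y1 x $ 5 = x$4" "Y1 x $ 6 = x$7" "Y1 x $ 7 = - x$6"
  by (simp_all add: Y1_def axis_def)

lemma Y2_nth [simp]:
  "Y2 x $ 0 = - x$2" "Y2 x $ 1 = - x$3" "Y2 x $ 2 = x$0" "Y2 x $ 3 = x$1"
  "Y2 x $ 4 = - x$6" "Y2 x $ 5 = - x$7" "Y2 x $ 6 = x$4" "Y2 x $ 7 = x$5"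
  by (simp_all add: Y2_def axis_def)

lemma Y3_nth [simp]:
  "Y3 x $ 0 = - x$3" "Y3 x $ 1 = x$2" "Y3 x $ 2 = - x$1" "Y3 x $ 3 = x$0"
  "Y3 x $ 4 = - x$7" "Y3 x $ 5 = x$6" "Y3 x $ 6 = - x$5" "Y3 x $ 7 = x$4"
  by (simp_all add: Y3_def axis_def)

lemma h2_eq:
  "h2 x V W = 2 * (x \<bullet> V) * (x \<bullet> W) + 2 * (x \<bullet> x) * (V \<bullet> W)
     - 2 * (Y1 x \<bullet> V) * (Y1 x \<bullet> W) - (Y2 x \<bullet> V) * (Y2 x \<bullet> W) - (Y3 x \<bullet> V) * (Y3 x \<bullet> W)"
proof -
  have Rsq: "Rsq = (\<lambda>x. x \<bullet> x)"
    by (simp add: fun_eq_iff Rsq_def inner_vec_def power2_eq_square)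
  have "(Rsq has_derivative (\<lambda>V. 2 * (x \<bullet> V))) (at x)"
    unfolding Rsq by (auto intro!: derivative_eq_intros simp: inner_commute)
  then have "frechet_derivative Rsq (at x) = (\<lambda>V. 2 * (x \<bullet> V))"
    by (metis frechet_derivative_at)
  then show ?thesis by (simp add: h2_def Rsq)
qed

lemma vector_3_axis: "(vector [a, b, c] :: real^3) = a *\<^sub>R axis 1 1 + b *\<^sub>R axis 2 1 + c *\<^sub>R axis 3 1"
  by (simp add: vec_eq_iff forall_3 axis_def)

definition DQ :: "real^8 \<Rightarrow> real^8 \<Rightarrow> (real^3) \<times> (real^3)" where
  "DQ x V =
    (vector [2 * (x$0 * V$0 + x$1 * V$1 - x$4 * V$4 - x$5 * V$5),
             2 * (x$0 * V$4 + x$4 * V$0 + x$1 * V$5 + x$5 * V$1),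
             2 * (x$0 * V$5 + x$5 * V$0 - x$1 * V$4 - x$4 * V$1)],
     vector [2 * (x$2 * V$2 + x$3 * V$3 - x$6 * V$6 - x$7 * V$7),
             2 * (x$2 * V$6 + x$6 * V$2 + x$3 * V$7 + x$7 * V$3),
             2 * (x$2 * V$7 + x$7 * V$2 - x$3 * V$6 - x$6 * V$3)])"

lemma Q_has_derivative: "(Q has_derivative DQ x) (at x)"
  unfolding Q_def[abs_def] DQ_def[abs_def] vector_3_axis
  by (auto intro!: derivative_eq_intros bounded_linear.has_derivative[OF bounded_linear_vec_nth]
      simp: algebra_simps fun_eq_iff)

lemma frechet_derivative_Q: "frechet_derivative Q (at x) = DQ x"
  using frechet_derivative_at[OF Q_has_derivative] by simp

section \<open>Lifts of tangent vectors through the pair of Hopf maps\<close>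

text \<open>In complex notation this is (Az, Bw), where A is the Hermitian matrix with rows (a1, a2
  - i a3) and (a2 + i a3, -a1), a combination of Pauli matrices, and B is built likewise from
  \<open>b\<close>.\<close>

definition lift :: "real^8 \<Rightarrow> real^3 \<Rightarrow> real^3 \<Rightarrow> real^8" where
  "lift x a b =
     (x$0 * a$1 + x$4 * a$2 + x$5 * a$3) *\<^sub>R dd 0 + (x$1 * a$1 + x$5 * a$2 - x$4 * a$3) *\<^sub>R dd 1
   + (x$2 * b$1 + x$6 * b$2 + x$7 * b$3) *\<^sub>R dd 2 + (x$3 * b$1 + x$7 * b$2 - x$6 * b$3) *\<^sub>R dd 3
   + (x$0 * a$2 - x$4 * a$1 - x$1 * a$3) *\<^sub>R dd 4 + (x$1 * a$2 - x$5 * a$1 + x$0 * a$3) *\<^sub>R dd 5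
   + (x$2 * b$2 - x$6 * b$1 - x$3 * b$3) *\<^sub>R dd 6 + (x$3 * b$2 - x$7 * b$1 + x$2 * b$3) *\<^sub>R dd 7"

lemma lift_nth [simp]:
  "lift x a b $ 0 = x$0 * a$1 + x$4 * a$2 + x$5 * a$3" "lift x a b $ 1 = x$1 * a$1 + x$5 * a$2 - x$4 * a$3"
  "lift x a b $ 2 = x$2 * b$1 + x$6 * b$2 + x$7 * b$3" "lift x a b $ 3 = x$3 * b$1 + x$7 * b$2 - x$6 * b$3"
  "lift x a b $ 4 = x$0 * a$2 - x$4 * a$1 - x$1 * a$3" "lift x a b $ 5 = x$1 * a$2 - x$5 * a$1 + x$0 * a$3"
  "lift x a b $ 6 = x$2 * b$2 - x$6 * b$1 - x$3 * b$3" "lift x a b $ 7 = x$3 * b$2 - x$7 * b$1 + x$2 * b$3"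
  by (simp_all add: lift_def axis_def)

lemma norm_eq_3: "t \<ge> 0 \<Longrightarrow> U$1 ^ 2 + U$2 ^ 2 + U$3 ^ 2 = t\<^sup>2 \<Longrightarrow> norm U = t" for U :: "real^3"
  by (simp add: norm_eq_sqrt_inner inner_3 power2_eq_square)

context
  fixes x :: "real^8" and U V :: "real^3"
  assumes Q: "Q x = (U, V)"
begin

lemma UV_nth:
  "U$1 = (x$0)\<^sup>2 + (x$1)\<^sup>2 - (x$4)\<^sup>2 - (x$5)\<^sup>2"
  "U$2 = 2 * (x$0 * x$4 + x$1 * x$5)" "U$3 = 2 * (x$0 * x$5 - x$1 * x$4)"
  "V$1 = (x$2)\<^sup>2 + (x$3)\<^sup>2 - (x$6)\<^sup>2 - (x$7)\<^sup>2"
  "V$2 = 2 * (x$2 * x$6 + x$3 * x$7)" "V$3 = 2 * (x$2 * x$7 - x$3 * x$6)"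
  using Q unfolding Q_def by auto

text \<open>The Hopf map squares lengths: the squares of its three components add up to the square
  of the right-hand side.\<close>

lemma norm_U: "norm U = (x$0)\<^sup>2 + (x$1)\<^sup>2 + (x$4)\<^sup>2 + (x$5)\<^sup>2"
  by (rule norm_eq_3; (simp add: UV_nth; fail)?) (simp add: UV_nth, algebra)

lemma norm_V: "norm V = (x$2)\<^sup>2 + (x$3)\<^sup>2 + (x$6)\<^sup>2 + (x$7)\<^sup>2"
  by (rule norm_eq_3; (simp add: UV_nth; fail)?) (simp add: UV_nth, algebra)

lemma inner_self_x: "x \<bullet> x = norm U + norm V"
  by (simp add: inner_8 norm_U norm_V power2_eq_square)

lemma inner_X: "X x \<bullet> X x = norm U + norm V" "x \<bullet> X x = 0" "Y1 x \<bullet> X x = norm U - norm V"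
  by (simp_all add: inner_8 norm_U norm_V power2_eq_square algebra_simps)

text \<open>Hermitian matrices have real quadratic forms, so Az is orthogonal to iz and Bw to iw;
  \<open>X\<close> is (iz, iw) and \<open>Y1\<close> is (iz, -iw). The last identity is the
  anticommutation rule AA' + A'A = 2(a.a')I.\<close>

lemma inner_lift:
  "x \<bullet> lift x a b = U \<bullet> a + V \<bullet> b" "X x \<bullet> lift x a b = 0" "Y1 x \<bullet> lift x a b = 0"
  "lift x a b \<bullet> lift x a' b' = norm U * (a \<bullet> a') + norm V * (b \<bullet> b')"
  by (simp_all add: inner_8 inner_3 UV_nth norm_U norm_V power2_eq_square algebra_simps)

text \<open>Anticommutation again: the components of \<open>Q\<close> are quadratic forms of Pauli
  matrices.\<close>

lemma DQ_lift: "DQ x (lift x a b) = ((2 * norm U) *\<^sub>R a, (2 * norm V) *\<^sub>R b)"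
  by (simp add: DQ_def vec_eq_iff forall_3 norm_U norm_V power2_eq_square algebra_simps)

text \<open>
  The \<open>Y\<^sub>2\<close>- and \<open>Y\<^sub>3\<close>-components of a tangent vector \<open>(dz, dw)\<close> are the real and imaginary parts of
  \<open>\<langle>z, dw\<rangle> - \<langle>dz, w\<rangle>\<close>, which is \<open>2i \<langle>z, w\<rangle>\<close> on \<open>X\<close> and \<open>\<langle>z, (b - a) w\<rangle>\<close> on a lift since Pauli matrices
  are Hermitian.  Products of these are traces of products of Pauli matrices.
\<close>

lemma Y23_X: "(Y2 x \<bullet> X x)\<^sup>2 + (Y3 x \<bullet> X x)\<^sup>2 = 2 * (norm U * norm V + U \<bullet> V)"
  unfolding inner_8 inner_3 UV_nth norm_U norm_V X_nth Y2_nth Y3_nth by algebra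

lemma Y23_lift:
  "(Y2 x \<bullet> lift x a b) * (Y2 x \<bullet> lift x a' b') + (Y3 x \<bullet> lift x a b) * (Y3 x \<bullet> lift x a' b') =
  ((norm U * norm V - U \<bullet> V) * ((b - a) \<bullet> (b' - a')) + (U \<bullet> (b - a)) * (V \<bullet> (b' - a'))
   + (V \<bullet> (b - a)) * (U \<bullet> (b' - a'))) / 2"
proof -
  have "2 * ((Y2 x \<bullet> lift x a b) * (Y2 x \<bullet> lift x a' b') + (Y3 x \<bullet> lift x a b) * (Y3 x \<bullet> lift x a' b')) =
  ((norm U * norm V - U \<bullet> V) * ((b - a) \<bullet> (b' - a')) + (U \<bullet> (b - a)) * (V \<bullet> (b' - a'))
   + (V \<bullet> (b - a)) * (U \<bullet> (b' - a')))"
    unfolding inner_8 inner_3 UV_nth norm_U norm_V lift_nth Y2_nth Y3_nth vector_minus_component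
    by algebra
  then show ?thesis by simp
qed

lemma Y23_X_lift:
  "(Y2 x \<bullet> X x) * (Y2 x \<bullet> lift x a b) + (Y3 x \<bullet> X x) * (Y3 x \<bullet> lift x a b) = cross3 V U \<bullet> (b - a)"
  unfolding inner_8 inner_3 UV_nth lift_nth Y2_nth Y3_nth X_nth vector_minus_component
    cross3_def vector_3
  by algebra


lemma h2_lift:
  "h2 x (lift x a b) (lift x a' b') = 2 * (U \<bullet> a + V \<bullet> b) * (U \<bullet> a' + V \<bullet> b')
     + 2 * (norm U + norm V) * (norm U * (a \<bullet> a') + norm V * (b \<bullet> b'))
     - ((norm U * norm V - U \<bullet> V) * ((b - a) \<bullet> (b' - a')) + (U \<bullet> (b - a)) * (V \<bullet> (b' - a'))
        + (V \<bullet> (b - a)) * (U \<bullet> (b' - a'))) / 2"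
  unfolding h2_eq inner_lift inner_self_x Y23_lift[symmetric] by simp

lemma h2_X_lift: "h2 x (X x) (lift x a b) = - (cross3 V U \<bullet> (b - a))"
  unfolding h2_eq using Y23_X_lift[of a b] by (simp add: inner_lift inner_X)

lemma N_eq: "N x = 6 * norm U * norm V - 2 * (U \<bullet> V)"
  unfolding N_def h2_eq using Y23_X
  by (simp add: inner_self_x inner_X power2_eq_square algebra_simps)

text \<open>Every tangent vector is a lift plus multiples of iz and iw; \<open>k\<close> and
  \<open>l\<close> are its inner products with these two. Multiplying by 2uv clears the
  denominators, so that only polynomial identities remain.\<close>

lemma decomposition_scaled:
  fixes W :: "real^8"
  defines "k \<equiv> x$0 * W$1 - x$1 * W$0 + x$4 * W$5 - x$5 * W$4"
    and "l \<equiv> x$2 * W$3 - x$3 * W$2 + x$6 * W$7 - x$7 * W$6"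
  shows "(2 * norm U * norm V) *\<^sub>R W = lift x (norm V *\<^sub>R fst (DQ x W)) (norm U *\<^sub>R snd (DQ x W))
    + (norm V * k + norm U * l) *\<^sub>R X x + (norm V * k - norm U * l) *\<^sub>R Y1 x"
  unfolding vec_eq_iff forall_8
  by (simp add: DQ_def norm_U norm_V k_def l_def) (intro conjI; algebra)

end

section \<open>Descent of the horizontal form to the quotient\<close>

lemma h2_sym: "h2 x V W = h2 x W V"
  by (simp add: h2_eq inner_commute)

lemma h2_add: "h2 x (V + V') W = h2 x V W + h2 x V' W"
  by (simp add: h2_eq inner_add_right inner_add_left algebra_simps)

lemma h2_scaleR: "h2 x (r *\<^sub>R V) W = r * h2 x V W"
  by (simp add: h2_eq algebra_simps)

text \<open>\<open>Y1\<close> has squared length \<open>x \<bullet> x\<close> and is orthogonal to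
  \<open>x\<close>, \<open>Y2\<close> and \<open>Y3\<close>, so the Euclidean term of
  \<open>h2\<close> cancels against the \<open>Y1\<close> term.\<close>

lemma h2_Y1: "h2 x (Y1 x) W = 0"
proof -
  have "x \<bullet> Y1 x = 0" "Y2 x \<bullet> Y1 x = 0" "Y3 x \<bullet> Y1 x = 0" "Y1 x \<bullet> Y1 x = x \<bullet> x"
    by (simp_all add: inner_8)
  then show ?thesis by (simp add: h2_eq)
qed

lemma lift_scaleR: "lift x (r *\<^sub>R a) (r *\<^sub>R b) = r *\<^sub>R lift x a b"
  by (simp add: vec_eq_iff forall_8 algebra_simps)

text \<open>The subtracted product is \<open>1/4 * N x\<close> times the square of
  \<open>Theta2\<close>, so this is the expected pullback of \<open>g2\<close>.\<close>

definition horizontal :: "real^8 \<Rightarrow> real^8 \<Rightarrow> real^8 \<Rightarrow> real" where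
  "horizontal x V W = h2 x V W - h2 x (X x) V * h2 x (X x) W / N x"

lemma horizontal_eq_iff:
  assumes "N x \<noteq> 0"
  shows "h2 x V W = t + 1/4 * N x * (Theta2 x V * Theta2 x W) \<longleftrightarrow> horizontal x V W = t"
  using assms by (auto simp: horizontal_def Theta2_def field_simps)

lemma horizontal_add_vertical:
  assumes "N x \<noteq> 0"
  shows "horizontal x (V + s *\<^sub>R X x + t *\<^sub>R Y1 x) (W + s' *\<^sub>R X x + t' *\<^sub>R Y1 x) = horizontal x V W"
proof -
  have left: "h2 x (V + s *\<^sub>R X x + t *\<^sub>R Y1 x) Z = h2 x V Z + s * h2 x (X x) Z" for V Z s t
    by (simp add: h2_add h2_scaleR h2_Y1)
  have right: "h2 x Z (V + s *\<^sub>R X x + t *\<^sub>R Y1 x) = h2 x Z V + s * h2 x (X x) Z" for V Z s t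
    using left h2_sym by metis
  show ?thesis
    using assms unfolding horizontal_def left right N_def[symmetric] h2_sym[of x V "X x"]
    by (simp add: field_simps)
qed

text \<open>Inverts the factors \<open>2u\<close> and \<open>2v\<close> in \<open>DQ_lift\<close>.\<close>

definition rescaled :: "(real^3) \<times> (real^3) \<Rightarrow> (real^3) \<times> (real^3) \<Rightarrow> (real^3) \<times> (real^3)" where
  "rescaled q \<alpha> = (fst \<alpha> /\<^sub>R (2 * norm (fst q)), snd \<alpha> /\<^sub>R (2 * norm (snd q)))"

text \<open>The value of \<open>horizontal\<close> on two lifts; the final quotient comes from
  \<open>h2_X_lift\<close> and \<open>N_eq\<close>. Only the base point \<open>(U, V)\<close>
  enters, not the point above it.\<close>

definition g2_lift :: "(real^3) \<times> (real^3) \<Rightarrow> (real^3) \<times> (real^3) \<Rightarrow> (real^3) \<times> (real^3) \<Rightarrow> real" where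
  "g2_lift = (\<lambda>(U, V) (a, b) (a', b').
     2 * (U \<bullet> a + V \<bullet> b) * (U \<bullet> a' + V \<bullet> b')
     + 2 * (norm U + norm V) * (norm U * (a \<bullet> a') + norm V * (b \<bullet> b'))
     - ((norm U * norm V - U \<bullet> V) * ((b - a) \<bullet> (b' - a')) + (U \<bullet> (b - a)) * (V \<bullet> (b' - a'))
        + (V \<bullet> (b - a)) * (U \<bullet> (b' - a'))) / 2
     - (cross3 V U \<bullet> (b - a)) * (cross3 V U \<bullet> (b' - a')) / (6 * norm U * norm V - 2 * (U \<bullet> V)))"

lemma bilinear_g2_lift: "bilinear (\<lambda>\<alpha> \<beta>. g2_lift q (rescaled q \<alpha>) (rescaled q \<beta>))"
  by (cases q) (auto simp: bilinear_def linear_iff g2_lift_def rescaled_def inner_simps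
    add_divide_distrib diff_divide_distrib algebra_simps)

text \<open>Cauchy-Schwarz bounds 6uv - 2 U.V below by 4uv.\<close>

lemma N_pos:
  assumes "Q x = q" "q \<in> regular"
  shows "N x > 0"
proof -
  obtain U V where q: "q = (U, V)" by force
  have "U \<bullet> V \<le> norm U * norm V" by (rule norm_cauchy_schwarz)
  moreover have "norm U * norm V > 0" using assms(2) by (auto simp: q regular_def)
  ultimately show ?thesis unfolding N_eq[OF assms(1)[unfolded q]] by linarith
qed

lemma horizontal_lift:
  assumes "Q x = (U, V)"
  shows "horizontal x (lift x a b) (lift x a' b') = g2_lift (U, V) (a, b) (a', b')"
  by (simp add: horizontal_def g2_lift_def h2_lift[OF assms] h2_X_lift[OF assms] N_eq[OF assms])

lemma decomposition:
  assumes "Q x = q" "q \<in> regular"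
  obtains s t where "W = lift x (fst (rescaled q (DQ x W))) (snd (rescaled q (DQ x W))) + s *\<^sub>R X x + t *\<^sub>R Y1 x"
proof -
  obtain U V where q: "q = (U, V)" by force
  define c where "c = 2 * norm U * norm V"
  have c: "c \<noteq> 0" using assms(2) by (auto simp: q regular_def c_def)
  obtain s t where *: "c *\<^sub>R W = lift x (norm V *\<^sub>R fst (DQ x W)) (norm U *\<^sub>R snd (DQ x W)) + s *\<^sub>R X x + t *\<^sub>R Y1 x"
    using decomposition_scaled[OF assms(1)[unfolded q]] unfolding c_def by blast
  have "norm V *\<^sub>R fst (DQ x W) = c *\<^sub>R fst (rescaled q (DQ x W))"
    "norm U *\<^sub>R snd (DQ x W) = c *\<^sub>R snd (rescaled q (DQ x W))"
    using c by (auto simp: rescaled_def q c_def)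
  with * have **: "c *\<^sub>R W = c *\<^sub>R lift x (fst (rescaled q (DQ x W))) (snd (rescaled q (DQ x W))) + s *\<^sub>R X x + t *\<^sub>R Y1 x"
    by (simp only: lift_scaleR)
  have "W = (1/c) *\<^sub>R (c *\<^sub>R W)" using c by simp
  also have "\<dots> = lift x (fst (rescaled q (DQ x W))) (snd (rescaled q (DQ x W))) + (s/c) *\<^sub>R X x + (t/c) *\<^sub>R Y1 x"
    unfolding ** using c by (simp add: scaleR_add_right)
  finally show thesis by (rule that)
qed

lemma horizontal_eq_g2_lift:
  assumes "Q x = q" "q \<in> regular"
  shows "horizontal x V W = g2_lift q (rescaled q (DQ x V)) (rescaled q (DQ x W))"
proof -
  have N: "N x \<noteq> 0" using N_pos[OF assms] by simp
  obtain s t where V: "V = lift x (fst (rescaled q (DQ x V))) (snd (rescaled q (DQ x V))) + s *\<^sub>R X x + t *\<^sub>R Y1 x"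
    using decomposition[OF assms] .
  obtain s' t' where W: "W = lift x (fst (rescaled q (DQ x W))) (snd (rescaled q (DQ x W))) + s' *\<^sub>R X x + t' *\<^sub>R Y1 x"
    using decomposition[OF assms] .
  have "horizontal x V W = horizontal x (lift x (fst (rescaled q (DQ x V))) (snd (rescaled q (DQ x V))))
      (lift x (fst (rescaled q (DQ x W))) (snd (rescaled q (DQ x W))))"
    using horizontal_add_vertical[OF N] V W by metis
  also have "\<dots> = g2_lift q (rescaled q (DQ x V)) (rescaled q (DQ x W))"
    using horizontal_lift[of x "fst q" "snd q"] assms(1) by simp
  finally show ?thesis .
qed

section \<open>Surjectivity, and existence and uniqueness of \<open>g2\<close>\<close>

lemma hopf_surj:
  fixes p q r :: real
  obtains a b c d :: real
  where "a\<^sup>2 + b\<^sup>2 - c\<^sup>2 - d\<^sup>2 = p" "2 * (a * c + b * d) = q" "2 * (a * d - b * c) = r"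
proof -
  define n where "n = sqrt (p\<^sup>2 + q\<^sup>2 + r\<^sup>2)"
  have n2: "n\<^sup>2 = p\<^sup>2 + q\<^sup>2 + r\<^sup>2" by (simp add: n_def)
  have "\<bar>p\<bar> \<le> n" unfolding n_def by (rule real_le_rsqrt) simp
  show thesis
  proof (cases "n + p = 0")
    \<comment> \<open>Here the first complex coordinate must vanish, and the second carries all of
      \<open>p\<close>.\<close>
    case True
    then have "n\<^sup>2 = p\<^sup>2" by (simp add: eq_neg_iff_add_eq_0[symmetric])
    with n2 have "q = 0" "r = 0" by (simp_all add: add_nonneg_eq_0_iff)
    moreover have "p \<le> 0" using True \<open>\<bar>p\<bar> \<le> n\<close> by linarith
    ultimately show thesis by (intro that[of 0 0 "sqrt (- p)" 0]) simp_all
  next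
    case False
    \<comment> \<open>The circle action allows \<open>b\<close> = 0. The squared length of the
      preimage is \<open>n\<close>, and adding the equation for \<open>p\<close> gives
      \<open>2 * a\<^sup>2 = n + p\<close>.\<close>
    define a where "a = sqrt ((n + p) / 2)"
    have a2: "2 * a\<^sup>2 = n + p" using \<open>\<bar>p\<bar> \<le> n\<close> by (simp add: a_def)
    then have a: "a \<noteq> 0" using False by auto
    have "q\<^sup>2 + r\<^sup>2 = (n + p) * (n - p)" using n2 by (simp add: power2_eq_square algebra_simps)
    also have "\<dots> = 2 * a\<^sup>2 * (2 * a\<^sup>2 - 2 * p)" unfolding a2 by simp
    finally have "(q / (2 * a))\<^sup>2 + (r / (2 * a))\<^sup>2 = a\<^sup>2 - p"
      using a by (simp add: power_divide power_mult_distrib field_simps)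
    then show thesis using a by (intro that[of a 0 "q / (2 * a)" "r / (2 * a)"]) simp_all
  qed
qed

lemma Q_surj: obtains x where "Q x = q"
proof -
  obtain U V where q: "q = (U, V)" by force
  obtain a b c d where 1: "a\<^sup>2 + b\<^sup>2 - c\<^sup>2 - d\<^sup>2 = U$1" "2 * (a * c + b * d) = U$2" "2 * (a * d - b * c) = U$3"
    using hopf_surj .
  obtain a' b' c' d' where 2: "a'\<^sup>2 + b'\<^sup>2 - c'\<^sup>2 - d'\<^sup>2 = V$1" "2 * (a' * c' + b' * d') = V$2" "2 * (a' * d' - b' * c') = V$3"
    using hopf_surj .
  define x :: "real^8" where "x = a *\<^sub>R dd 0 + b *\<^sub>R dd 1 + a' *\<^sub>R dd 2 + b' *\<^sub>R dd 3
    + c *\<^sub>R dd 4 + d *\<^sub>R dd 5 + c' *\<^sub>R dd 6 + d' *\<^sub>R dd 7"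
  have "x$0 = a" "x$1 = b" "x$2 = a'" "x$3 = b'" "x$4 = c" "x$5 = d" "x$6 = c'" "x$7 = d'"
    by (simp_all add: x_def axis_def)
  with 1 2 have "Q x = q" unfolding q Q_def by (simp add: vec_eq_iff forall_3)
  then show thesis by (rule that)
qed

lemma DQ_surj:
  assumes "Q x = q" "q \<in> regular"
  obtains V where "DQ x V = \<alpha>"
proof
  show "DQ x (lift x (fst (rescaled q \<alpha>)) (snd (rescaled q \<alpha>))) = \<alpha>"
    using DQ_lift[of x "fst q" "snd q"] assms
    by (cases q; cases \<alpha>) (auto simp: rescaled_def regular_def)
qed

text \<open>Resolves the definite description. Existence is \<open>horizontal_eq_g2_lift\<close>;
  for uniqueness, some \<open>x\<close> lies over \<open>q\<close> and \<open>DQ x\<close> is onto,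
  so the condition prescribes every value of the form.\<close>

lemma g2_eq:
  assumes "q \<in> regular"
  shows "g2 q \<alpha> \<beta> = g2_lift q (rescaled q \<alpha>) (rescaled q \<beta>)"
proof -
  have iff: "(h2 x V W = t + 1/4 * N x * (Theta2 x V * Theta2 x W))
      \<longleftrightarrow> t = g2_lift q (rescaled q (DQ x V)) (rescaled q (DQ x W))" if "Q x = q" for x V W t
  proof -
    have N: "N x \<noteq> 0" using N_pos[OF that assms] by simp
    show ?thesis unfolding horizontal_eq_iff[OF N] horizontal_eq_g2_lift[OF that assms] by (rule eq_commute)
  qed
  have "g2 q = (\<lambda>\<alpha> \<beta>. g2_lift q (rescaled q \<alpha>) (rescaled q \<beta>))"
    unfolding g2_def frechet_derivative_Q
  proof (rule the_equality)
    show "bilinear (\<lambda>\<alpha> \<beta>. g2_lift q (rescaled q \<alpha>) (rescaled q \<beta>)) \<and> (\<forall>x V W. Q x = q \<longrightarrow>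
        h2 x V W = g2_lift q (rescaled q (DQ x V)) (rescaled q (DQ x W)) + 1/4 * N x * (Theta2 x V * Theta2 x W))"
      using bilinear_g2_lift iff by blast
  next
    fix g assume g: "bilinear g \<and> (\<forall>x V W. Q x = q \<longrightarrow>
        h2 x V W = g (DQ x V) (DQ x W) + 1/4 * N x * (Theta2 x V * Theta2 x W))"
    obtain x where x: "Q x = q" by (rule Q_surj)
    show "g = (\<lambda>\<alpha> \<beta>. g2_lift q (rescaled q \<alpha>) (rescaled q \<beta>))"
    proof (intro ext)
      fix \<alpha> \<beta>
      obtain V W where "DQ x V = \<alpha>" "DQ x W = \<beta>" using DQ_surj[OF x assms] by metis
      with g iff x show "g \<alpha> \<beta> = g2_lift q (rescaled q \<alpha>) (rescaled q \<beta>)" by metis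
    qed
  qed
  then show ?thesis by simp
qed

section \<open>Restriction to the two submanifolds\<close>

lemma frechet_derivative_param:
  "frechet_derivative (param \<epsilon>) (at (R, \<phi>, \<sigma>)) (dR, d\<phi>, d\<sigma>) =
    ((dR * (cos (\<phi>/2))\<^sup>2 - R * cos (\<phi>/2) * sin (\<phi>/2) * d\<phi>) *\<^sub>R \<sigma> + (R * (cos (\<phi>/2))\<^sup>2) *\<^sub>R d\<sigma>,
     \<epsilon> *\<^sub>R ((dR * (sin (\<phi>/2))\<^sup>2 + R * sin (\<phi>/2) * cos (\<phi>/2) * d\<phi>) *\<^sub>R \<sigma> + (R * (sin (\<phi>/2))\<^sup>2) *\<^sub>R d\<sigma>))"
proof -
  have "(param \<epsilon> has_derivative (\<lambda>(dR, d\<phi>, d\<sigma>).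
    ((dR * (cos (\<phi>/2))\<^sup>2 - R * cos (\<phi>/2) * sin (\<phi>/2) * d\<phi>) *\<^sub>R \<sigma> + (R * (cos (\<phi>/2))\<^sup>2) *\<^sub>R d\<sigma>,
     \<epsilon> *\<^sub>R ((dR * (sin (\<phi>/2))\<^sup>2 + R * sin (\<phi>/2) * cos (\<phi>/2) * d\<phi>) *\<^sub>R \<sigma> + (R * (sin (\<phi>/2))\<^sup>2) *\<^sub>R d\<sigma>))))
    (at (R, \<phi>, \<sigma>))"
    unfolding param_def case_prod_beta
    by (rule derivative_eq_intros refl | simp)+ (auto simp: fun_eq_iff algebra_simps)
  from frechet_derivative_at[OF this] show ?thesis by (metis (no_types, lifting) case_prod_conv)
qed

text \<open>For \<epsilon> = 1 the factor uv - U.V vanishes and b - a is the radial vector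
  \<open>(q - p) *\<^sub>R \<sigma>\<close>. For \<epsilon> = -1 the factor is 2uv, and the radial
  part of its term cancels against the two mixed products, leaving the spherical part.\<close>

lemma g2_lift_on_F:
  fixes \<sigma> d\<sigma> d\<sigma>' :: "real^3" and u v :: real
  assumes "\<epsilon> * \<epsilon> = 1" "u > 0" "v > 0" "norm \<sigma> = 1" "\<sigma> \<bullet> d\<sigma> = 0" "\<sigma> \<bullet> d\<sigma>' = 0"
  shows "g2_lift (u *\<^sub>R \<sigma>, \<epsilon> *\<^sub>R (v *\<^sub>R \<sigma>))
      (p *\<^sub>R \<sigma> + d\<sigma> /\<^sub>R 2, \<epsilon> *\<^sub>R (q *\<^sub>R \<sigma> + d\<sigma> /\<^sub>R 2))
      (p' *\<^sub>R \<sigma> + d\<sigma>' /\<^sub>R 2, \<epsilon> *\<^sub>R (q' *\<^sub>R \<sigma> + d\<sigma>' /\<^sub>R 2)) =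
    2 * (u * p + v * q) * (u * p' + v * q')
    + 2 * (u + v) * (u * p * p' + v * q * q' + (u + v) / 4 * (d\<sigma> \<bullet> d\<sigma>'))
    - u * v * (if \<epsilon> = 1 then (q - p) * (q' - p') else d\<sigma> \<bullet> d\<sigma>')"
proof -
  have [simp]: "\<sigma> \<bullet> \<sigma> = 1" "d\<sigma> \<bullet> \<sigma> = 0" "d\<sigma>' \<bullet> \<sigma> = 0" using assms by (simp_all add: norm_eq_1 inner_commute)
  have "cross3 (\<epsilon> *\<^sub>R (v *\<^sub>R \<sigma>)) (u *\<^sub>R \<sigma>) = 0" by (simp add: cross_mult_left cross_mult_right)
  moreover have "\<epsilon> = 1 \<or> \<epsilon> = -1" using assms(1) by (simp add: square_eq_1_iff)
  ultimately show ?thesis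
    using assms by (elim disjE) (simp_all add: g2_lift_def inner_simps field_simps)
qed

lemma g2_on_F_eq:
  assumes "\<epsilon> * \<epsilon> = 1" "R > 0" "norm \<sigma> = 1" "\<sigma> \<bullet> d\<sigma> = 0" "\<sigma> \<bullet> d\<sigma>' = 0"
    and reg: "param \<epsilon> (R, \<phi>, \<sigma>) \<in> regular"
  shows "g2_on_F \<epsilon> (R, \<phi>, \<sigma>) (dR, d\<phi>, d\<sigma>) (dR', d\<phi>', d\<sigma>') =
    dR * dR' + R\<^sup>2 / 2 * (d\<phi> * d\<phi>' + d\<sigma> \<bullet> d\<sigma>')
    - R\<^sup>2 / 4 * (if \<epsilon> = 1 then d\<phi> * d\<phi>' else (sin \<phi>)\<^sup>2 * (d\<sigma> \<bullet> d\<sigma>'))"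
proof -
  define c s where "c = cos (\<phi>/2)" and "s = sin (\<phi>/2)"
  define u v where "u = R * c\<^sup>2" and "v = R * s\<^sup>2"
  \<comment> \<open>These are du/(2u) and dv/(2v), the radial parts of the rescaled
    derivative.\<close>
  define p q where "p = (\<lambda>dR d\<phi>. dR / (2 * R) - s / c * (d\<phi> / 2))" and "q = (\<lambda>dR d\<phi>. dR / (2 * R) + c / s * (d\<phi> / 2))"
  let ?q = "(u *\<^sub>R \<sigma>, \<epsilon> *\<^sub>R (v *\<^sub>R \<sigma>))"
  have eps: "\<bar>\<epsilon>\<bar> = 1" using assms(1) by (auto simp: square_eq_1_iff)
  have param: "param \<epsilon> (R, \<phi>, \<sigma>) = ?q" by (simp add: param_def u_def v_def c_def s_def)
  \<comment> \<open>Regularity excludes the zeros of \<open>c\<close> and \<open>s\<close>, which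
    occur as denominators in \<open>p\<close> and \<open>q\<close>.\<close>
  have nz: "c \<noteq> 0" "s \<noteq> 0" using reg unfolding param by (auto simp: regular_def u_def v_def)
  have cs: "c\<^sup>2 + s\<^sup>2 = 1" by (simp add: c_def s_def)
  have uv: "u > 0" "v > 0" "u + v = R"
    using nz \<open>R > 0\<close> cs by (auto simp: u_def v_def distrib_left[symmetric])
  have half: "rescaled ?q (frechet_derivative (param \<epsilon>) (at (R, \<phi>, \<sigma>)) (dR, d\<phi>, d\<sigma>))
      = (p dR d\<phi> *\<^sub>R \<sigma> + d\<sigma> /\<^sub>R 2, \<epsilon> *\<^sub>R (q dR d\<phi> *\<^sub>R \<sigma> + d\<sigma> /\<^sub>R 2))" for dR d\<phi> d\<sigma>
  proof -
    have "u * p dR d\<phi> = (dR * c\<^sup>2 - R * c * s * d\<phi>) / 2" "v * q dR d\<phi> = (dR * s\<^sup>2 + R * s * c * d\<phi>) / 2"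
      using nz \<open>R > 0\<close> by (simp_all add: u_def v_def p_def q_def power2_eq_square field_simps)
    then have "dR * c\<^sup>2 - R * c * s * d\<phi> = 2 * u * p dR d\<phi>" "dR * s\<^sup>2 + R * s * c * d\<phi> = 2 * v * q dR d\<phi>"
      by simp_all
    then show ?thesis
      unfolding frechet_derivative_param c_def[symmetric] s_def[symmetric] u_def[symmetric] v_def[symmetric]
      using uv eps assms(3) by (simp add: rescaled_def scaleR_add_right abs_mult mult_ac)
  qed
  have 1: "u * p dR d\<phi> + v * q dR d\<phi> = dR / 2" for dR d\<phi>
  proof -
    have "u * p dR d\<phi> + v * q dR d\<phi> = (c\<^sup>2 + s\<^sup>2) * dR / 2"
      using nz \<open>R > 0\<close> by (simp add: u_def v_def p_def q_def power2_eq_square field_simps)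
    then show ?thesis using cs by simp
  qed
  have 2: "u * p dR d\<phi> * p dR' d\<phi>' + v * q dR d\<phi> * q dR' d\<phi>' = dR * dR' / (4 * R) + R * d\<phi> * d\<phi>' / 4"
  proof -
    have "u * p dR d\<phi> * p dR' d\<phi>' + v * q dR d\<phi> * q dR' d\<phi>' = (c\<^sup>2 + s\<^sup>2) * (dR * dR' / (4 * R) + R * d\<phi> * d\<phi>' / 4)"
      using nz \<open>R > 0\<close> by (simp add: u_def v_def p_def q_def power2_eq_square field_simps)
    then show ?thesis using cs by simp
  qed
  have sc: "q dR d\<phi> - p dR d\<phi> = d\<phi> / (2 * s * c)" for dR d\<phi>
  proof -
    have "q dR d\<phi> - p dR d\<phi> = (c\<^sup>2 + s\<^sup>2) * d\<phi> / (2 * s * c)"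
      using nz \<open>R > 0\<close> by (simp add: p_def q_def power2_eq_square field_simps)
    then show ?thesis using cs by simp
  qed
  \<comment> \<open>\<open>u * v\<close> equals \<open>R\<^sup>2 * s\<^sup>2 * c\<^sup>2\<close>,
    which removes all dependence on \<phi> from the coefficient.\<close>
  have 3: "u * v * ((q dR d\<phi> - p dR d\<phi>) * (q dR' d\<phi>' - p dR' d\<phi>')) = R\<^sup>2 / 4 * (d\<phi> * d\<phi>')"
    unfolding sc using nz by (simp add: u_def v_def power2_eq_square)
  have 4: "u * v = R\<^sup>2 / 4 * (sin \<phi>)\<^sup>2"
    using sin_double[of "\<phi>/2"] by (simp add: u_def v_def c_def s_def power2_eq_square)
  have eq: "g2_on_F \<epsilon> (R, \<phi>, \<sigma>) (dR, d\<phi>, d\<sigma>) (dR', d\<phi>', d\<sigma>') =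
      2 * (dR / 2) * (dR' / 2) + 2 * R * (dR * dR' / (4 * R) + R * d\<phi> * d\<phi>' / 4 + R / 4 * (d\<sigma> \<bullet> d\<sigma>'))
      - u * v * (if \<epsilon> = 1 then (q dR d\<phi> - p dR d\<phi>) * (q dR' d\<phi>' - p dR' d\<phi>') else d\<sigma> \<bullet> d\<sigma>')"
    unfolding g2_on_F_def param g2_eq[OF reg[unfolded param]] half
      g2_lift_on_F[OF assms(1) uv(1,2) assms(3-5)] 1 2 uv(3) ..
  show ?thesis
  proof (cases "\<epsilon> = 1")
    case True
    then show ?thesis
      unfolding eq if_P[OF True] 3 using \<open>R > 0\<close> by (simp add: power2_eq_square algebra_simps)
  next
    case False
    then show ?thesis
      unfolding eq 4 using \<open>R > 0\<close> by (simp add: power2_eq_square algebra_simps)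
  qed
qed

theorem corollary8p3:
  fixes R \<phi> :: real and \<sigma> :: "real^3"
    and dR d\<phi> dR' d\<phi>' :: real and d\<sigma> d\<sigma>' :: "real^3"
  assumes "R > 0" and "\<phi> \<in> {0..pi}" and "\<sigma> \<in> sphere 0 1"
    and "\<sigma> \<bullet> d\<sigma> = 0" and "\<sigma> \<bullet> d\<sigma>' = 0"
  shows "(param 1 (R, \<phi>, \<sigma>) \<in> F 1 \<inter> regular \<longrightarrow>
           g2_on_F 1 (R, \<phi>, \<sigma>) (dR, d\<phi>, d\<sigma>) (dR', d\<phi>', d\<sigma>') =
             dR * dR' + R\<^sup>2 * (1/2 * (d\<sigma> \<bullet> d\<sigma>') + 1/4 * (d\<phi> * d\<phi>'))) \<and>
         (param (-1) (R, \<phi>, \<sigma>) \<in> F (-1) \<inter> regular \<longrightarrow>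
           g2_on_F (-1) (R, \<phi>, \<sigma>) (dR, d\<phi>, d\<sigma>) (dR', d\<phi>', d\<sigma>') =
             dR * dR' + R\<^sup>2 * (1/8 * (3 + cos (2 * \<phi>)) * (d\<sigma> \<bullet> d\<sigma>') + 1/2 * (d\<phi> * d\<phi>')))"
proof -
  have \<sigma>: "norm \<sigma> = 1" using assms(3) by simp
  \<comment> \<open>Matches the coefficient 1/2 - (1/4) sin^2 \<phi> from \<open>g2_on_F_eq\<close>
    with (3 + cos 2\<phi>)/8.\<close>
  have "cos (2 * \<phi>) = 1 - 2 * (sin \<phi>)\<^sup>2" by (rule cos_double_sin)
  then have cos: "3 + cos (2 * \<phi>) = 4 - 2 * (sin \<phi>)\<^sup>2" by simp
  show ?thesis unfolding cos
    by (auto simp: g2_on_F_eq[OF _ assms(1) \<sigma> assms(4,5)] algebra_simps)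
qed

end
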